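(* Let $f\colon M\to M$ be a homeomorphism of a compact metric space $(M,d)$. A pseudo-orbit map for $f$ induces shadowing if and only if it is a shadowing map. In particular, every homeomorphism (of a compact metric space) with a shadowing map has the shadowing property.
   Context: $\tilde M=M^{\mathbb Z}$ has the product topology; $\sigma\colon\tilde M\to\tilde M$ is the shift, $(\sigma(x))_i=x_{i+1}$; for $p\in M$, $\mathrm{orb}_f(p)\in\tilde M$ is given by $(\mathrm{orb}_f(p))_i=f^i(p)$. For $\delta\ge 0$, $\tilde M(f,\delta)=\{x\in\tilde M: d(x_{i+1},f(x_i))\le\delta\ \forall i\in\mathbb Z\}$; its elements are called $\delta$-orbits. A point $p$ is an $\epsilon$-shadow of $x$ if $d(f^i(p),x_i)\le\epsilon$ for all $i\in\mathbb Z$. $f$ has the shadowing property if for all $\epsilon>0$ there is $\delta>0$ such that every $\delta$-orbit has an $\epsilon$-shadow. A pseudo-orbit map for $f$ is a continuous map $\mathrm{Sh}_f\colon\tilde M(f,\delta)\to M$ (for some $\delta>0$) with $\mathrm{Sh}_f(\mathrm{orb}_f(p))=p$ for all $p\in M$. It induces shadowing if for all $\epsilon>0$ there is $\gamma\in(0,\delta]$ such that for all $x\in\tilde M(f,\gamma)$ the point $\mathrm{Sh}_f(x)$ is an $\epsilon$-shadow of $x$. It is a shadowing map if for all $\epsilon>0$ there is $\gamma\in(0,\delta]$ such that $d(f^i(\mathrm{Sh}_f(x)),\mathrm{Sh}_f(\sigma^i(x)))\le\epsilon$ for all $x\in\tilde M(f,\gamma)$ and $i\in\mathbb Z$. *)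

theory Defs
  imports "HOL-Analysis.Analysis"
begin

text \<open>
  The compact metric space is a set \<open>M\<close> in a type of class \<open>metric_space\<close>; maps on \<open>M\<close> are
  total functions of which only the values on \<open>M\<close> matter.
\<close>

text \<open>Integer iterates of a bijection of \<open>S\<close> onto itself; the inverse is taken on \<open>S\<close>.\<close>

definition int_iter :: "'b set \<Rightarrow> ('b \<Rightarrow> 'b) \<Rightarrow> int \<Rightarrow> 'b \<Rightarrow> 'b" where
  "int_iter S h i = (if 0 \<le> i then h ^^ nat i else inv_into S h ^^ nat (- i))"

definition seq_space :: "'a set \<Rightarrow> (int \<Rightarrow> 'a) set" where
  "seq_space M = (UNIV \<rightarrow> M)"

definition shift :: "(int \<Rightarrow> 'a) \<Rightarrow> int \<Rightarrow> 'a" where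
  "shift x = (\<lambda>i. x (i + 1))"

definition orb :: "'a set \<Rightarrow> ('a \<Rightarrow> 'a) \<Rightarrow> 'a \<Rightarrow> int \<Rightarrow> 'a" where
  "orb M f p = (\<lambda>i. int_iter M f i p)"

definition pseudo_orbits :: "'a::metric_space set \<Rightarrow> ('a \<Rightarrow> 'a) \<Rightarrow> real \<Rightarrow> (int \<Rightarrow> 'a) set" where
  "pseudo_orbits M f \<delta> = {x \<in> seq_space M. \<forall>i. dist (x (i + 1)) (f (x i)) \<le> \<delta>}"

definition is_shadow :: "'a::metric_space set \<Rightarrow> ('a \<Rightarrow> 'a) \<Rightarrow> real \<Rightarrow> (int \<Rightarrow> 'a) \<Rightarrow> 'a \<Rightarrow> bool" where
  "is_shadow M f \<epsilon> x p \<longleftrightarrow> p \<in> M \<and> (\<forall>i. dist (int_iter M f i p) (x i) \<le> \<epsilon>)"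

definition shadowing_property :: "'a::metric_space set \<Rightarrow> ('a \<Rightarrow> 'a) \<Rightarrow> bool" where
  "shadowing_property M f \<longleftrightarrow>
    (\<forall>\<epsilon>>0. \<exists>\<delta>>0. \<forall>x\<in>pseudo_orbits M f \<delta>. \<exists>p. is_shadow M f \<epsilon> x p)"

text \<open>
  The domain \<open>pseudo_orbits M f \<delta>\<close> is part of the data of a pseudo-orbit map, hence the
  parameter \<open>\<delta>\<close> below. Continuity refers to the topology on the function type
  \<open>int \<Rightarrow> 'a\<close>, which is the product topology.
\<close>

definition pseudo_orbit_map ::
    "'a::metric_space set \<Rightarrow> ('a \<Rightarrow> 'a) \<Rightarrow> real \<Rightarrow> ((int \<Rightarrow> 'a) \<Rightarrow> 'a) \<Rightarrow> bool" where
  "pseudo_orbit_map M f \<delta> Sh \<longleftrightarrow>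
    \<delta> > 0 \<and>
    Sh \<in> pseudo_orbits M f \<delta> \<rightarrow> M \<and>
    continuous_on (pseudo_orbits M f \<delta>) Sh \<and>
    (\<forall>p\<in>M. Sh (orb M f p) = p)"

definition induces_shadowing ::
    "'a::metric_space set \<Rightarrow> ('a \<Rightarrow> 'a) \<Rightarrow> real \<Rightarrow> ((int \<Rightarrow> 'a) \<Rightarrow> 'a) \<Rightarrow> bool" where
  "induces_shadowing M f \<delta> Sh \<longleftrightarrow>
    (\<forall>\<epsilon>>0. \<exists>\<gamma>\<in>{0<..\<delta>}. \<forall>x\<in>pseudo_orbits M f \<gamma>. is_shadow M f \<epsilon> x (Sh x))"

definition shadowing_map ::
    "'a::metric_space set \<Rightarrow> ('a \<Rightarrow> 'a) \<Rightarrow> real \<Rightarrow> ((int \<Rightarrow> 'a) \<Rightarrow> 'a) \<Rightarrow> bool" where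
  "shadowing_map M f \<delta> Sh \<longleftrightarrow>
    pseudo_orbit_map M f \<delta> Sh \<and>
    (\<forall>\<epsilon>>0. \<exists>\<gamma>\<in>{0<..\<delta>}. \<forall>x\<in>pseudo_orbits M f \<gamma>. \<forall>i.
      dist (int_iter M f i (Sh x)) (Sh (int_iter (seq_space M) shift i x)) \<le> \<epsilon>)"

end

theory Submission
  imports Defs
begin

text \<open>
  Both conditions compare the true orbit of \<open>Sh x\<close> with a second sequence: inducing shadowing
  compares it with \<open>x\<close> itself, being a shadowing map compares it with the sequence of values
  \<open>Sh (\<sigma>\<^sup>i x)\<close>. The two second sequences are uniformly close, because \<open>x\<^sub>i\<close> is the zeroth entry of
  \<open>\<sigma>\<^sup>i x\<close> and because \<open>Sh y\<close> is close to \<open>y\<^sub>0\<close> whenever \<open>y\<close> is a \<open>\<gamma>\<close>-orbit for small \<open>\<gamma>\<close>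
  (\<open>pseudo_orbit_map_close_to_zeroth\<close>). The equivalence is then the triangle inequality.

  The closeness of \<open>Sh y\<close> to \<open>y\<^sub>0\<close> comes from compactness of the sequence space: \<open>\<gamma>\<close>-orbits
  accumulate, as \<open>\<gamma>\<close> tends to \<open>0\<close>, only at true orbits, and on a true orbit a pseudo-orbit map
  returns exactly the zeroth entry.
\<close>

text \<open>
  Injectivity lets a solution of \<open>u\<^sub>i\<^sub>+\<^sub>1 = h(u\<^sub>i)\<close> be followed backwards as well as forwards, so it is
  determined by \<open>u\<^sub>0\<close>. The case of \<open>f\<close> identifies the \<open>0\<close>-orbits with true orbits; the case
  of the shift computes its integer iterates.
\<close>

lemma int_iter_recurrence:
  assumes "inj_on h S" and "\<And>i. u i \<in> S" and step: "\<And>i. u (i + 1) = h (u i)"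
  shows "int_iter S h i (u 0) = u i"
proof -
  have forward: "(h ^^ n) (u 0) = u (int n)" for n
    by (induction n) (simp_all add: step[symmetric] add.commute)
  have pred: "inv_into S h (u i) = u (i - 1)" for i
    using inv_into_f_f[OF assms(1,2), of "i - 1"] step[of "i - 1"] by simp
  have backward: "(inv_into S h ^^ n) (u 0) = u (- int n)" for n
    by (induction n) (auto simp: pred intro!: arg_cong[where f = u])
  show ?thesis
    by (simp add: int_iter_def forward backward)
qed

lemma inj_on_shift: "inj_on shift A"
proof (rule inj_onI)
  fix x y :: "int \<Rightarrow> 'a" assume "shift x = shift y"
  then have "x (i - 1 + 1) = y (i - 1 + 1)" for i
    unfolding shift_def by metis
  then show "x = y" by (simp add: fun_eq_iff)
qed

lemma int_iter_shift:
  assumes "x \<in> seq_space M"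
  shows "int_iter (seq_space M) shift i x = (\<lambda>j. x (i + j))"
  using int_iter_recurrence[of shift "seq_space M" "\<lambda>i j. x (i + j)" i] assms
  by (auto simp: inj_on_shift shift_def seq_space_def ac_simps)

lemma pseudo_orbits_shifted:
  assumes "x \<in> pseudo_orbits M f \<gamma>"
  shows "(\<lambda>j. x (i + j)) \<in> pseudo_orbits M f \<gamma>"
  using assms by (auto simp: pseudo_orbits_def seq_space_def add.assoc[symmetric])

lemma pseudo_orbits_mono: "\<gamma> \<le> \<delta> \<Longrightarrow> pseudo_orbits M f \<gamma> \<subseteq> pseudo_orbits M f \<delta>"
  unfolding pseudo_orbits_def by (blast intro: order_trans)

lemma tendsto_coordinate:
  fixes x :: "nat \<Rightarrow> 'i \<Rightarrow> 'a::topological_space"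
  assumes "x \<longlonglongrightarrow> l"
  shows "(\<lambda>n. x n i) \<longlonglongrightarrow> l i"
  by (rule continuous_on_tendsto_compose[OF continuous_on_product_coordinates assms]) simp_all

lemma compact_seq_space:
  fixes M :: "'a::metric_space set"
  assumes "compact M"
  shows "compact (seq_space M)"
proof -
  have "compactin (product_topology (\<lambda>_. euclidean) UNIV) (PiE (UNIV::int set) (\<lambda>_. M))"
    using assms by (simp add: compactin_PiE)
  then show ?thesis
    by (simp add: seq_space_def PiE_UNIV_domain euclidean_product_topology)
qed

lemma zero_orbit_eq_orb:
  assumes "inj_on f M" and "x \<in> pseudo_orbits M f 0"
  shows "orb M f (x 0) = x"
  using int_iter_recurrence[of f M x] assms
  by (auto simp: orb_def pseudo_orbits_def seq_space_def fun_eq_iff)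

text \<open>
  Pseudo-orbits with errors tending to \<open>0\<close> accumulate only at true orbits, since each of the
  conditions \<open>d(x\<^sub>i\<^sub>+\<^sub>1, f(x\<^sub>i)) \<le> \<gamma>\<close> involves just two coordinates and so passes to limits in the
  product topology.
\<close>

lemma pseudo_orbits_limit:
  assumes cont: "continuous_on M f" and x: "\<And>n. x n \<in> pseudo_orbits M f (c n)"
    and "c \<longlonglongrightarrow> 0" and lim: "x \<longlonglongrightarrow> l" and l: "l \<in> seq_space M"
  shows "l \<in> pseudo_orbits M f 0"
proof -
  have coord: "(\<lambda>n. x n i) \<longlonglongrightarrow> l i" for i
    using lim by (rule tendsto_coordinate)
  have "dist (l (i + 1)) (f (l i)) \<le> 0" for i
  proof (rule LIMSEQ_le)
    have "(\<lambda>n. f (x n i)) \<longlonglongrightarrow> f (l i)"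
      using x l by (intro continuous_on_tendsto_compose[OF cont coord] always_eventually)
        (auto simp: pseudo_orbits_def seq_space_def)
    then show "(\<lambda>n. dist (x n (i + 1)) (f (x n i))) \<longlonglongrightarrow> dist (l (i + 1)) (f (l i))"
      by (intro tendsto_dist coord)
    show "c \<longlonglongrightarrow> 0" by fact
    show "\<exists>N. \<forall>n\<ge>N. dist (x n (i + 1)) (f (x n i)) \<le> c n"
      using x by (auto simp: pseudo_orbits_def)
  qed
  then show ?thesis using l by (simp add: pseudo_orbits_def)
qed

text \<open>
  Otherwise there are \<open>x\<^sub>n\<close> with errors tending to \<open>0\<close> and \<open>Sh x\<^sub>n\<close> at distance more than \<open>\<epsilon>\<close> from
  the zeroth entry. A limit \<open>l\<close> of a subsequence is a true orbit, so \<open>Sh l = l\<^sub>0\<close>, against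
  continuity of \<open>Sh\<close>.
\<close>

lemma pseudo_orbit_map_close_to_zeroth:
  assumes "compact M" and cont: "continuous_on M f" and inj: "inj_on f M"
    and Sh: "pseudo_orbit_map M f \<delta> Sh" and "\<epsilon> > 0"
  shows "\<exists>\<gamma>\<in>{0<..\<delta>}. \<forall>x\<in>pseudo_orbits M f \<gamma>. dist (Sh x) (x 0) \<le> \<epsilon>"
proof (rule ccontr)
  assume "\<not> ?thesis"
  then have bad: "\<exists>x\<in>pseudo_orbits M f \<gamma>. dist (Sh x) (x 0) > \<epsilon>" if "\<gamma> \<in> {0<..\<delta>}" for \<gamma>
    using that by (meson not_le)
  have "\<delta> > 0" and cSh: "continuous_on (pseudo_orbits M f \<delta>) Sh"
    and orb: "\<And>p. p \<in> M \<Longrightarrow> Sh (orb M f p) = p"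
    using Sh by (auto simp: pseudo_orbit_map_def)
  define c where "c n = \<delta> / real (Suc n)" for n
  have c: "c n \<in> {0<..\<delta>}" for n
    using \<open>\<delta> > 0\<close> by (simp add: c_def field_simps)
  have c0: "c \<longlonglongrightarrow> 0"
    unfolding c_def by (rule LIMSEQ_Suc) (rule lim_const_over_n)
  obtain x where x: "\<And>n. x n \<in> pseudo_orbits M f (c n)" and far: "\<And>n. dist (Sh (x n)) (x n 0) > \<epsilon>"
    using bad[OF c] by metis
  have "x n \<in> seq_space M" for n
    using x by (simp add: pseudo_orbits_def)
  then obtain l r where l: "l \<in> seq_space M" and r: "strict_mono (r :: nat \<Rightarrow> nat)"
    and lim: "(x \<circ> r) \<longlonglongrightarrow> l"
    using seq_compactE[OF compact_imp_seq_compact[OF compact_seq_space[OF \<open>compact M\<close>]]] by blast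
  have l0: "l \<in> pseudo_orbits M f 0"
    using pseudo_orbits_limit[OF cont _ LIMSEQ_subseq_LIMSEQ[OF c0 r] lim l] x by simp
  then have Shl: "Sh l = l 0"
    using orb[of "l 0"] zero_orbit_eq_orb[OF inj] l by (auto simp: seq_space_def)
  have dom: "x n \<in> pseudo_orbits M f \<delta>" for n
    using x c pseudo_orbits_mono[of "c n" \<delta> M f] by fastforce
  have "(\<lambda>n. Sh ((x \<circ> r) n)) \<longlonglongrightarrow> Sh l"
  proof (rule continuous_on_tendsto_compose[OF cSh lim])
    show "l \<in> pseudo_orbits M f \<delta>"
      using l0 pseudo_orbits_mono[of 0 \<delta> M f] \<open>\<delta> > 0\<close> by auto
  qed (simp add: dom)
  then have "(\<lambda>n. Sh (x (r n))) \<longlonglongrightarrow> Sh l"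
    by simp
  moreover have "(\<lambda>n. x (r n) 0) \<longlonglongrightarrow> l 0"
    using tendsto_coordinate[OF lim] by simp
  ultimately have "(\<lambda>n. dist (Sh (x (r n))) (x (r n) 0)) \<longlonglongrightarrow> dist (Sh l) (l 0)"
    by (rule tendsto_dist)
  then have "\<epsilon> \<le> dist (Sh l) (l 0)"
    by (rule LIMSEQ_le_const) (use far less_imp_le in blast)
  then show False using Shl \<open>\<epsilon> > 0\<close> by simp
qed

text \<open>
  The distance from \<open>Sh (\<sigma>\<^sup>i x)\<close> to \<open>x\<^sub>i\<close> is the time-zero instance of shadowing for the
  pseudo-orbit \<open>\<sigma>\<^sup>i x\<close>.
\<close>

lemma induces_shadowing_imp_shadowing_map:
  assumes Sh: "pseudo_orbit_map M f \<delta> Sh" and ind: "induces_shadowing M f \<delta> Sh"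
  shows "shadowing_map M f \<delta> Sh"
  unfolding shadowing_map_def
proof (intro conjI Sh allI impI)
  fix \<epsilon> :: real assume "\<epsilon> > 0"
  then obtain \<gamma> where \<gamma>: "\<gamma> \<in> {0<..\<delta>}"
    and shadow: "\<And>x. x \<in> pseudo_orbits M f \<gamma> \<Longrightarrow> is_shadow M f (\<epsilon> / 2) x (Sh x)"
    using ind unfolding induces_shadowing_def by (meson half_gt_zero)
  have "dist (int_iter M f i (Sh x)) (Sh (int_iter (seq_space M) shift i x)) \<le> \<epsilon>"
    if x: "x \<in> pseudo_orbits M f \<gamma>" for x i
  proof -
    let ?y = "\<lambda>j. x (i + j)"
    have "dist (int_iter M f i (Sh x)) (x i) \<le> \<epsilon> / 2"
      using shadow[OF x] by (simp add: is_shadow_def)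
    moreover have "dist (int_iter M f 0 (Sh ?y)) (?y 0) \<le> \<epsilon> / 2"
      using shadow[OF pseudo_orbits_shifted[OF x]] unfolding is_shadow_def by blast
    then have "dist (Sh ?y) (x i) \<le> \<epsilon> / 2"
      by (simp add: int_iter_def)
    ultimately have "dist (int_iter M f i (Sh x)) (Sh ?y) \<le> \<epsilon>"
      using dist_triangle2[of "int_iter M f i (Sh x)" "Sh ?y" "x i"] by linarith
    then show ?thesis
      using x by (simp add: int_iter_shift pseudo_orbits_def)
  qed
  with \<gamma> show "\<exists>\<gamma>\<in>{0<..\<delta>}. \<forall>x\<in>pseudo_orbits M f \<gamma>. \<forall>i.
      dist (int_iter M f i (Sh x)) (Sh (int_iter (seq_space M) shift i x)) \<le> \<epsilon>"
    by blast
qed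

text \<open>
  Here the same distance is bounded by \<open>pseudo_orbit_map_close_to_zeroth\<close>, applied to the
  shifted pseudo-orbit.
\<close>

lemma shadowing_map_imp_induces_shadowing:
  assumes "compact M" and "continuous_on M f" and inj: "inj_on f M"
    and map: "shadowing_map M f \<delta> Sh"
  shows "induces_shadowing M f \<delta> Sh"
  unfolding induces_shadowing_def
proof (intro allI impI)
  fix \<epsilon> :: real assume "\<epsilon> > 0"
  have Sh: "pseudo_orbit_map M f \<delta> Sh"
    using map by (simp add: shadowing_map_def)
  obtain \<gamma>\<^sub>1 where \<gamma>1: "\<gamma>\<^sub>1 \<in> {0<..\<delta>}"
    and zeroth: "\<And>x. x \<in> pseudo_orbits M f \<gamma>\<^sub>1 \<Longrightarrow> dist (Sh x) (x 0) \<le> \<epsilon> / 2"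
    using pseudo_orbit_map_close_to_zeroth[OF assms(1,2) inj Sh
        half_gt_zero[OF \<open>\<epsilon> > 0\<close>]] by blast
  obtain \<gamma>\<^sub>2 where \<gamma>2: "\<gamma>\<^sub>2 \<in> {0<..\<delta>}"
    and equiv: "\<And>x i. x \<in> pseudo_orbits M f \<gamma>\<^sub>2 \<Longrightarrow>
      dist (int_iter M f i (Sh x)) (Sh (int_iter (seq_space M) shift i x)) \<le> \<epsilon> / 2"
    using map half_gt_zero[OF \<open>\<epsilon> > 0\<close>] unfolding shadowing_map_def by meson
  have "is_shadow M f \<epsilon> x (Sh x)" if x: "x \<in> pseudo_orbits M f (min \<gamma>\<^sub>1 \<gamma>\<^sub>2)" for x
  proof -
    have x1: "x \<in> pseudo_orbits M f \<gamma>\<^sub>1" and x2: "x \<in> pseudo_orbits M f \<gamma>\<^sub>2"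
      using x pseudo_orbits_mono[of "min \<gamma>\<^sub>1 \<gamma>\<^sub>2" \<gamma>\<^sub>1 M f]
        pseudo_orbits_mono[of "min \<gamma>\<^sub>1 \<gamma>\<^sub>2" \<gamma>\<^sub>2 M f] by auto
    have "dist (int_iter M f i (Sh x)) (x i) \<le> \<epsilon>" for i
    proof -
      let ?y = "\<lambda>j. x (i + j)"
      have "dist (int_iter M f i (Sh x)) (Sh ?y) \<le> \<epsilon> / 2"
        using equiv[OF x2, of i] x by (simp add: int_iter_shift pseudo_orbits_def)
      moreover have "dist (Sh ?y) (x i) \<le> \<epsilon> / 2"
        using zeroth[OF pseudo_orbits_shifted[OF x1, of i]] by simp
      ultimately show ?thesis
        using dist_triangle[of "int_iter M f i (Sh x)" "x i" "Sh ?y"] by linarith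
    qed
    moreover have "Sh x \<in> M"
      using Sh x1 \<gamma>1 pseudo_orbits_mono[of \<gamma>\<^sub>1 \<delta> M f] by (auto simp: pseudo_orbit_map_def)
    ultimately show ?thesis by (simp add: is_shadow_def)
  qed
  then show "\<exists>\<gamma>\<in>{0<..\<delta>}. \<forall>x\<in>pseudo_orbits M f \<gamma>. is_shadow M f \<epsilon> x (Sh x)"
    using \<gamma>1 \<gamma>2 by (intro bexI[of _ "min \<gamma>\<^sub>1 \<gamma>\<^sub>2"]) auto
qed

lemma induces_shadowing_imp_shadowing_property:
  assumes "induces_shadowing M f \<delta> Sh"
  shows "shadowing_property M f"
  using assms unfolding induces_shadowing_def shadowing_property_def
  by (meson greaterThanAtMost_iff)

theorem proposition3p2:
  fixes M :: "'a::metric_space set" and f g :: "'a \<Rightarrow> 'a"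
  assumes "compact M" and "homeomorphism M M f g"
  shows "(\<forall>\<delta> Sh. pseudo_orbit_map M f \<delta> Sh \<longrightarrow>
            (induces_shadowing M f \<delta> Sh \<longleftrightarrow> shadowing_map M f \<delta> Sh)) \<and>
         ((\<exists>\<delta> Sh. shadowing_map M f \<delta> Sh) \<longrightarrow> shadowing_property M f)"
proof -
  have cont: "continuous_on M f" and inj: "inj_on f M"
    using assms(2) by (auto simp: homeomorphism_def intro: inj_on_inverseI)
  show ?thesis
    using induces_shadowing_imp_shadowing_map induces_shadowing_imp_shadowing_property
      shadowing_map_imp_induces_shadowing[OF assms(1) cont inj] by blast
qed

end
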